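(* For real $t$ with $t^2<\frac12$ let $$\begin{aligned}M_t(x,y,z)={}&(1-2t^2)(x^4y^2+x^2y^4)+t^4(x^4z^2+y^4z^2)\\&-(3-8t^2+2t^4)x^2y^2z^2-2t^2(x^2+y^2)z^4+z^6.\end{aligned}$$ Then $M_t\in\Delta_{3,6}$, $M_t$ has exactly ten zeros if $t\neq0$, and $M_0=M$.
   Context: $M(x,y,z)=x^4y^2+x^2y^4+z^6-3x^2y^2z^2$. $\Delta_{3,6}$ is the set of real ternary sextic forms that are psd (nonnegative on $\mathbb R^3$) but not sos (not a finite sum of squares of real forms). The zeros of a form are its nonzero real zeros, counted as lines through the origin (real projective points). *)

theory Defs
  imports "HOL-Analysis.Analysis"
begin

text \<open>
  Since the reals are infinite, a real form is determined by the function it induces, so a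
  ternary form of degree \<open>d\<close> is taken to be a polynomial function on \<open>\<real>\<^sup>3\<close> all of whose monomials
  have degree \<open>d\<close>; the zero form counts as a form of every degree.
\<close>

definition ternary_form :: "nat \<Rightarrow> (real^3 \<Rightarrow> real) \<Rightarrow> bool" where
  "ternary_form d f \<longleftrightarrow>
     (\<exists>c :: nat \<Rightarrow> nat \<Rightarrow> nat \<Rightarrow> real. \<forall>v. f v =
        (\<Sum>(i, j, k) \<in> {(i, j, k). i + j + k = d}. c i j k * (v $ 1) ^ i * (v $ 2) ^ j * (v $ 3) ^ k))"

lemma finite_exponents: "finite {(i, j, k). i + j + k = (d :: nat)}"
  by (rule finite_subset[of _ "{..d} \<times> {..d} \<times> {..d}"]) auto

definition psd :: "(real^3 \<Rightarrow> real) \<Rightarrow> bool" where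
  "psd f \<longleftrightarrow> (\<forall>v. 0 \<le> f v)"

definition sos :: "(real^3 \<Rightarrow> real) \<Rightarrow> bool" where
  "sos f \<longleftrightarrow>
     (\<exists>hs. (\<forall>h \<in> set hs. \<exists>d. ternary_form d h) \<and> (\<forall>v. f v = (\<Sum>h\<leftarrow>hs. (h v)\<^sup>2)))"

definition Delta_3_6 :: "(real^3 \<Rightarrow> real) set" where
  "Delta_3_6 = {f. ternary_form 6 f \<and> psd f \<and> \<not> sos f}"

text \<open>The real projective point of a nonzero vector is the line it spans.\<close>

definition form_zeros :: "(real^3 \<Rightarrow> real) \<Rightarrow> (real^3) set set" where
  "form_zeros f = {span {v} | v. v \<noteq> 0 \<and> f v = 0}"

definition M :: "real^3 \<Rightarrow> real" where
  "M v = (let x = v $ 1; y = v $ 2; z = v $ 3 in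
     x^4 * y^2 + x^2 * y^4 + z^6 - 3 * x^2 * y^2 * z^2)"

definition Mt :: "real \<Rightarrow> real^3 \<Rightarrow> real" where
  "Mt t v = (let x = v $ 1; y = v $ 2; z = v $ 3 in
     (1 - 2 * t^2) * (x^4 * y^2 + x^2 * y^4) + t^4 * (x^4 * z^2 + y^4 * z^2)
     - (3 - 8 * t^2 + 2 * t^4) * x^2 * y^2 * z^2 - 2 * t^2 * (x^2 + y^2) * z^4 + z^6)"

end

theory Submission
  imports Defs
begin

text \<open>
  Put \<open>s = t\<^sup>2\<close>, \<open>u = x\<^sup>2 + y\<^sup>2\<close>, \<open>p = x\<^sup>2y\<^sup>2\<close>, \<open>c = z\<^sup>2\<close>. Then \<open>M\<^sub>t\<close> is affine in \<open>p\<close>, which ranges over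
  \<open>[0, u\<^sup>2/4]\<close>, with values \<open>c(su - c)\<^sup>2\<close> and \<open>(c - u/2)\<^sup>2(c + (1 - 2s)u)\<close> at the two ends. Interpolating
  between them shows that \<open>M\<^sub>t\<close> is psd and locates its zeros. If \<open>M\<^sub>t\<close> were a sum of squares, every
  nonzero summand would, by scaling, be the square of a cubic \<open>h\<close> with \<open>h\<^sup>2 \<le> M\<^sub>t\<close>; restricting to \<open>x = 0\<close> and \<open>y = 0\<close> and
  evaluating at the zeros \<open>(1, \<plusminus>1, \<plusminus>1)\<close> forces the coefficient of \<open>z\<^sup>3\<close> in \<open>h\<close> to vanish, whereas
  \<open>M\<^sub>t(0, 0, 1) = 1\<close>.
\<close>

section \<open>Ternary forms in coordinates\<close>

text \<open>Nested index ranges let the simplifier expand a form of concrete degree into its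
  monomials.\<close>

lemma sum_exponents:
  fixes g :: "nat \<Rightarrow> nat \<Rightarrow> nat \<Rightarrow> 'a::comm_monoid_add"
  shows "(\<Sum>(i, j, k) \<in> {(i, j, k). i + j + k = d}. g i j k) =
         (\<Sum>i\<le>d. \<Sum>j\<le>d - i. g i j (d - i - j))"
proof -
  have "(\<Sum>i\<le>d. \<Sum>j\<le>d - i. g i j (d - i - j)) =
      (\<Sum>(i, j) \<in> (SIGMA i:{..d}. {..d - i}). g i j (d - i - j))"
    by (rule sum.Sigma) auto
  also have "\<dots> = (\<Sum>(i, j, k) \<in> {(i, j, k). i + j + k = d}. g i j k)"
    by (rule sum.reindex_bij_witness[where i = "\<lambda>(i, j, k). (i, j)"
          and j = "\<lambda>(i, j). (i, j, d - i - j)"]) auto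
  finally show ?thesis ..
qed

lemma ternary_form_scaleR:
  assumes "ternary_form d f"
  shows "f (r *\<^sub>R v) = r ^ d * f v"
proof -
  obtain c where c: "\<And>v. f v =
      (\<Sum>(i, j, k) \<in> {(i, j, k). i + j + k = d}. c i j k * (v $ 1) ^ i * (v $ 2) ^ j * (v $ 3) ^ k)"
    using assms unfolding ternary_form_def by blast
  show ?thesis
    unfolding c sum_distrib_left
    by (rule sum.cong) (auto simp: power_mult_distrib power_add)
qed

lemma ternary_form_3E:
  assumes "ternary_form 3 h"
  obtains a b c d e f g k l m where
    "\<And>x y z. h (vector [x, y, z]) = a * x^3 + b * y^3 + c * x^2 * y + d * x * y^2 + e * x^2 * z
       + f * y^2 * z + g * x * y * z + k * x * z^2 + l * y * z^2 + m * z^3"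
proof -
  obtain c where "\<And>v. h v =
      (\<Sum>(i, j, k) \<in> {(i, j, k). i + j + k = 3}. c i j k * (v $ 1) ^ i * (v $ 2) ^ j * (v $ 3) ^ k)"
    using assms unfolding ternary_form_def by blast
  then have "h (vector [x, y, z]) = c 3 0 0 * x^3 + c 0 3 0 * y^3 + c 2 1 0 * x^2 * y
       + c 1 2 0 * x * y^2 + c 2 0 1 * x^2 * z + c 0 2 1 * y^2 * z + c 1 1 1 * x * y * z
       + c 1 0 2 * x * z^2 + c 0 1 2 * y * z^2 + c 0 0 3 * z^3" for x y z
    by (simp add: sum_exponents vector_3 eval_nat_numeral)
  then show thesis by (rule that)
qed

lemma Mt_vector:
  "Mt t (vector [x, y, z]) =
     (1 - 2 * t^2) * (x^4 * y^2 + x^2 * y^4) + t^4 * (x^4 * z^2 + y^4 * z^2)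
     - (3 - 8 * t^2 + 2 * t^4) * x^2 * y^2 * z^2 - 2 * t^2 * (x^2 + y^2) * z^4 + z^6"
  by (simp add: Mt_def vector_3)

lemma vec3_eq: "(v :: real^3) = vector [v $ 1, v $ 2, v $ 3]"
  by (simp add: vec_eq_iff forall_3 vector_3)

lemma ternary_form_Mt: "ternary_form 6 (Mt t)"
proof -
  \<comment> \<open>Only triples with sum 6 are summed, so \<open>i\<close> and \<open>j\<close>
    determine \<open>k\<close>.\<close>
  define c :: "nat \<Rightarrow> nat \<Rightarrow> nat \<Rightarrow> real" where "c i j k =
    (if (i, j) \<in> {(4, 2), (2, 4)} then 1 - 2 * t^2
     else if (i, j) \<in> {(4, 0), (0, 4)} then t^4
     else if (i, j) = (2, 2) then - (3 - 8 * t^2 + 2 * t^4)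
     else if (i, j) \<in> {(2, 0), (0, 2)} then - 2 * t^2
     else if (i, j) = (0, 0) then 1 else 0)" for i j k
  have "Mt t v = (\<Sum>(i, j, k) \<in> {(i, j, k). i + j + k = 6}.
      c i j k * (v $ 1) ^ i * (v $ 2) ^ j * (v $ 3) ^ k)" for v
    unfolding sum_exponents
    by (simp add: Mt_def c_def Let_def eval_nat_numeral) (simp add: algebra_simps)
  then show ?thesis unfolding ternary_form_def by blast
qed

section \<open>Nonnegativity and zeros\<close>

text \<open>With u and p as above, the interpolation weights times u^2 are u^2 - 4p =
  \<open>(x^2 - y^2)^2\<close> and 4p; the factor 4 turns (c - u/2)^2 into (2c - u)^2.\<close>

lemma Mt_interpolation:
  "(x^2 + y^2)^2 * Mt t (vector [x, y, z]) =
     (x^2 - y^2)^2 * (z * (t^2 * (x^2 + y^2) - z^2))^2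
     + (x * y * (2 * z^2 - (x^2 + y^2)))^2 * (z^2 + (1 - 2 * t^2) * (x^2 + y^2))"
  unfolding Mt_vector by algebra

lemma psd_Mt:
  assumes "t^2 < 1/2"
  shows "psd (Mt t)"
proof -
  have "0 \<le> Mt t (vector [x, y, z])" for x y z
  proof (cases "x^2 + y^2 = 0")
    \<comment> \<open>Here the interpolation identity reads 0 = 0, but \<open>x = y = 0\<close>
      leaves only z^6.\<close>
    case True
    then show ?thesis by (simp add: Mt_vector sum_power2_eq_zero_iff)
  next
    case False
    then have "0 < (x^2 + y^2)^2" by simp
    moreover have "0 \<le> (x^2 + y^2)^2 * Mt t (vector [x, y, z])"
      unfolding Mt_interpolation using assms by (intro add_nonneg_nonneg mult_nonneg_nonneg) auto
    ultimately show ?thesis by (simp only: zero_le_mult_iff) linarith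
  qed
  then show ?thesis unfolding psd_def by (metis vec3_eq)
qed

text \<open>Both terms of the interpolation are nonnegative and the last factor is positive, so both
  squared products vanish. Of the resulting combinations of factors, only two are
  consistent.\<close>

lemma Mt_eq_0_iff:
  assumes "t^2 < 1/2" and "x \<noteq> 0 \<or> y \<noteq> 0"
  shows "Mt t (vector [x, y, z]) = 0 \<longleftrightarrow>
    x^2 = y^2 \<and> z^2 = x^2 \<or> x * y = 0 \<and> (z = 0 \<or> z^2 = t^2 * (x^2 + y^2))"
proof -
  have u: "0 < x^2 + y^2" using assms(2) by (simp add: sum_power2_gt_zero_iff)
  have "0 < (1 - 2 * t^2) * (x^2 + y^2)" using assms(1) u by simp
  then have pos: "0 < z^2 + (1 - 2 * t^2) * (x^2 + y^2)"
    by (simp add: add_nonneg_pos)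
  have "Mt t (vector [x, y, z]) = 0 \<longleftrightarrow> (x^2 + y^2)^2 * Mt t (vector [x, y, z]) = 0"
    using assms(2) by auto
  also have "\<dots> \<longleftrightarrow> (x^2 = y^2 \<or> z = 0 \<or> z^2 = t^2 * (x^2 + y^2))
      \<and> (x * y = 0 \<or> 2 * z^2 = x^2 + y^2)"
  proof -
    have *: "A\<^sup>2 * B\<^sup>2 + C\<^sup>2 * D = 0 \<longleftrightarrow> (A = 0 \<or> B = 0) \<and> C = 0" if "0 < D" for A B C D :: real
      using that by (subst add_nonneg_eq_0_iff) auto
    show ?thesis unfolding Mt_interpolation *[OF pos] by auto
  qed
  also have "\<dots> \<longleftrightarrow>
      x^2 = y^2 \<and> z^2 = x^2 \<or> x * y = 0 \<and> (z = 0 \<or> z^2 = t^2 * (x^2 + y^2))"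
  proof -
    \<comment> \<open>This excludes the mixed combinations: the first would give
      \<open>x = y = 0\<close>, the second contradicts u > 0 and 2t^2 < 1.\<close>
    have "x * y \<noteq> 0" if "x^2 = y^2" using that assms(2) by auto
    moreover have "2 * z^2 \<noteq> x^2 + y^2" if "z = 0 \<or> z^2 = t^2 * (x^2 + y^2)"
    proof
      assume "2 * z^2 = x^2 + y^2"
      with that u have "(1 - 2 * t^2) * (x^2 + y^2) = 0" by (auto simp: algebra_simps)
      with \<open>0 < (1 - 2 * t^2) * (x^2 + y^2)\<close> show False by simp
    qed
    ultimately show ?thesis by auto
  qed
  finally show ?thesis .
qed

section \<open>Failure of the sum of squares property\<close>

text \<open>On the line through \<open>v\<close> the bound compares r^(2d) with r^(2n): large r
  rules out d > n, small r rules out d < n. This handles summands of arbitrary degree in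
  \<open>sos\<close>.\<close>

lemma ternary_form_square_le:
  assumes h: "ternary_form d h" and f: "ternary_form (2 * n) f"
    and le: "\<And>v. (h v)\<^sup>2 \<le> f v" and "d \<noteq> n"
  shows "h v = 0"
proof (rule ccontr)
  assume "h v \<noteq> 0"
  have bound: "r ^ (2 * d) * (h v)\<^sup>2 \<le> r ^ (2 * n) * f v" for r
    using le[of "r *\<^sub>R v"]
    by (simp add: ternary_form_scaleR[OF h] ternary_form_scaleR[OF f] power_mult_distrib
        power_mult[symmetric] mult.commute)
  have hpos: "0 < (h v)\<^sup>2" using \<open>h v \<noteq> 0\<close> by simp
  then have fpos: "0 < f v" using le[of v] by linarith
  \<comment> \<open>Chosen so that scaling by \<open>q\<close> (if n < d) or by \<open>1 / q\<close>
    (if d < n) already violates the bound, whatever the positive gap \<open>Suc m\<close> between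
    the exponents.\<close>
  define q where "q = f v / (h v)\<^sup>2 + 1"
  have q: "1 < q" "f v < q * (h v)\<^sup>2" using hpos fpos by (auto simp: q_def field_simps)
  have *: "\<not> q ^ Suc m * (h v)\<^sup>2 \<le> f v" for m
  proof -
    have "q * 1 \<le> q * q ^ m" using q(1) by (intro mult_left_mono one_le_power) auto
    then have "q * (h v)\<^sup>2 \<le> q ^ Suc m * (h v)\<^sup>2" by (intro mult_right_mono) auto
    with q(2) show ?thesis by linarith
  qed
  from \<open>d \<noteq> n\<close> consider "n < d" | "d < n" by linarith
  then show False
  proof cases
    case 1
    then obtain m where m: "2 * d = 2 * n + Suc m"
      by (metis add_Suc_right less_imp_add_positive less_natE mult_2 add.assoc add.left_commute)
    have "q ^ (2 * n) * (q ^ Suc m * (h v)\<^sup>2) \<le> q ^ (2 * n) * f v"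
      using bound[of q] unfolding m power_add by (simp add: mult.assoc)
    then show False using * q(1) by (simp del: power_Suc)
  next
    case 2
    then obtain m where m: "2 * n = 2 * d + Suc m"
      by (metis add_Suc_right less_imp_add_positive less_natE mult_2 add.assoc add.left_commute)
    have "(1 / q) ^ (2 * d) * (h v)\<^sup>2 \<le> (1 / q) ^ (2 * d) * ((1 / q) ^ Suc m * f v)"
      using bound[of "1 / q"] unfolding m power_add by (simp add: mult.assoc)
    then have "(h v)\<^sup>2 \<le> (1 / q) ^ Suc m * f v" using q(1) by (simp del: power_Suc)
    then have "q ^ Suc m * (h v)\<^sup>2 \<le> f v"
      using q(1) by (simp add: field_simps power_one_over del: power_Suc)
    then show False using * by blast
  qed
qed

text \<open>For t nonzero the quadratic inherits the roots 1/t and -1/t of the right side, hence is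
  a multiple of it before squaring. For t = 0 it is bounded, hence constant.\<close>

lemma quadratic_square_le:
  fixes a b c t :: real
  assumes le: "\<And>x. (a * x^2 + b * x + c)^2 \<le> (t^2 * x^2 - 1)^2"
  shows "a = - c * t^2" "b = 0"
proof -
  have "a = - c * t^2 \<and> b = 0"
  proof (cases "t = 0")
    case False
    have root: "a * x^2 + b * x + c = 0" if "t^2 * x^2 = 1" for x
      using le[of x] that by simp
    have "a * (1 / t)^2 + b * (1 / t) + c = 0" "a * (- 1 / t)^2 + b * (- 1 / t) + c = 0"
      using False by (intro root; simp add: power_divide)+
    then have "a + b * t + c * t^2 = 0" "a - b * t + c * t^2 = 0"
      using False by (auto simp: field_simps power2_eq_square)
    then have "a + c * t^2 = 0" "b * t = 0" by linarith+
    with False show ?thesis by simp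
  next
    case True
    then have *: "\<bar>a * x^2 + b * x + c\<bar> \<le> 1" for x
      using le[of x] by (simp add: abs_square_le_1)
    \<comment> \<open>Half the difference of the values at \<open>x\<close> and \<open>- x\<close>
      isolates the odd part.\<close>
    have b: "\<bar>b * x\<bar> \<le> 1" for x using *[of x] *[of "- x"] by (simp add: abs_le_iff)
    have "b = 0"
      using b[of "2 / b"] by (cases "b = 0") auto
    moreover have "a = 0"
    proof (rule ccontr)
      assume "a \<noteq> 0"
      have "\<bar>a * x^2\<bar> \<le> 2" for x using *[of x] *[of 0] \<open>b = 0\<close> by simp
      \<comment> \<open>At this point the left side equals 3.\<close>
      from this[of "sqrt (3 / \<bar>a\<bar>)"] \<open>a \<noteq> 0\<close> show False by (simp add: abs_mult)
    qed
    ultimately show ?thesis using True by simp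
  qed
  then show "a = - c * t^2" "b = 0" by auto
qed

lemma cubic_square_le_Mt:
  assumes t: "t^2 < 1/2" and h: "ternary_form 3 h" and le: "\<And>v. (h v)\<^sup>2 \<le> Mt t v"
  shows "h (vector [0, 0, 1]) = 0"
proof -
  obtain a b c d e f g k l m where
    h: "\<And>x y z. h (vector [x, y, z]) = a * x^3 + b * y^3 + c * x^2 * y + d * x * y^2 + e * x^2 * z
       + f * y^2 * z + g * x * y * z + k * x * z^2 + l * y * z^2 + m * z^3"
    using ternary_form_3E[OF assms(2)] by metis
  have zero: "h (vector [x, y, z]) = 0" if "Mt t (vector [x, y, z]) = 0" for x y z
    using le[of "vector [x, y, z]"] that by simp
  have a: "a = 0" using zero[of 1 0 0] by (simp add: Mt_vector h)
  have b: "b = 0" using zero[of 0 1 0] by (simp add: Mt_vector h)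
  \<comment> \<open>On y = 0, z = 1 the form \<open>Mt t\<close> is a perfect square and, as a = 0,
    \<open>h\<close> is only quadratic in x.\<close>
  have "(e * x^2 + k * x + m)^2 \<le> (t^2 * x^2 - 1)^2" for x
  proof -
    have "Mt t (vector [x, 0, 1]) = (t^2 * x^2 - 1)^2" by (simp add: Mt_vector) algebra
    with le[of "vector [x, 0, 1]"] show ?thesis by (simp add: h a)
  qed
  from quadratic_square_le[OF this] have ek: "e = - m * t^2" "k = 0" .
  have "(f * y^2 + l * y + m)^2 \<le> (t^2 * y^2 - 1)^2" for y
  proof -
    have "Mt t (vector [0, y, 1]) = (t^2 * y^2 - 1)^2" by (simp add: Mt_vector) algebra
    with le[of "vector [0, y, 1]"] show ?thesis by (simp add: h b)
  qed
  from quadratic_square_le[OF this] have fl: "f = - m * t^2" "l = 0" .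
  have "h (vector [1, y, z]) = 0" if "y^2 = 1" "z^2 = 1" for y z
    using that t by (intro zero) (simp add: Mt_eq_0_iff)
  from this[of 1 1] this[of "- 1" 1] this[of 1 "- 1"] this[of "- 1" "- 1"]
  have "c + d - 2 * m * t^2 + g + m = 0" "- c + d - 2 * m * t^2 - g + m = 0"
    "c + d + 2 * m * t^2 - g - m = 0" "- c + d + 2 * m * t^2 + g - m = 0"
    by (simp_all add: h a b ek fl)
  \<comment> \<open>The first two equations minus the last two cancel \<open>c\<close>,
    \<open>d\<close> and \<open>g\<close>.\<close>
  then have "m - 2 * m * t^2 = 0" by linarith
  then have "(1 - 2 * t^2) * m = 0" by (simp add: algebra_simps)
  then have "m = 0" using t by simp
  then show ?thesis by (simp add: h)
qed

lemma not_sos_Mt: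
  assumes t: "t^2 < 1/2"
  shows "\<not> sos (Mt t)"
proof
  assume "sos (Mt t)"
  then obtain hs where form: "\<And>h. h \<in> set hs \<Longrightarrow> \<exists>d. ternary_form d h"
    and sum: "\<And>v. Mt t v = (\<Sum>h\<leftarrow>hs. (h v)\<^sup>2)"
    unfolding sos_def by blast
  have "h (vector [0, 0, 1]) = 0" if "h \<in> set hs" for h
  proof -
    have le: "(h v)\<^sup>2 \<le> Mt t v" for v
      unfolding sum by (rule member_le_sum_list) (use that in auto)
    from form[OF that] obtain d where d: "ternary_form d h" ..
    show ?thesis
    proof (cases "d = 3")
      case True
      then show ?thesis using cubic_square_le_Mt[OF t _ le] d by simp
    next
      case False
      have "ternary_form (2 * 3) (Mt t)" using ternary_form_Mt[of t] by simp
      from ternary_form_square_le[OF d this le False] show ?thesis .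
    qed
  qed
  then have "(\<Sum>h\<leftarrow>hs. (h (vector [0, 0, 1]))\<^sup>2) = (\<Sum>h\<leftarrow>hs. 0)"
    by (intro arg_cong[of _ _ sum_list] map_cong) auto
  then have "Mt t (vector [0, 0, 1]) = 0" unfolding sum by simp
  then show False by (simp add: Mt_vector)
qed

section \<open>Counting projective zeros\<close>

text \<open>Picks one representative on each line except the z-axis, which contains no zero of
  \<open>Mt t\<close>.\<close>

definition normalized :: "real^3 \<Rightarrow> bool" where
  "normalized v \<longleftrightarrow> v $ 1 = 1 \<or> v $ 1 = 0 \<and> v $ 2 = 1"

lemma inj_on_span_normalized: "inj_on (\<lambda>v. span {v}) (Collect normalized)"
proof (rule inj_onI)
  fix v w assume vw: "v \<in> Collect normalized" "w \<in> Collect normalized" and "span {v} = span {w}"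
  then have "v \<in> span {w}" using span_base[of v "{v}"] by simp
  then obtain r where r: "v = r *\<^sub>R w" by (auto simp: span_singleton)
  with vw have "r = 1" by (auto simp: normalized_def)
  with r show "v = w" by simp
qed

text \<open>Divide by the first nonzero entry among the first two; both vanish only on the z-axis,
  which \<open>no_zero\<close> excludes.\<close>

lemma form_zeros_normalized:
  assumes f: "ternary_form d f" and no_zero: "f (vector [0, 0, 1]) \<noteq> 0"
  shows "form_zeros f = (\<lambda>v. span {v}) ` {v. normalized v \<and> f v = 0}"
proof (intro equalityI subsetI)
  fix L assume "L \<in> form_zeros f"
  then obtain v where v: "v \<noteq> 0" "f v = 0" and L: "L = span {v}" by (auto simp: form_zeros_def)
  define r where "r = (if v $ 1 \<noteq> 0 then v $ 1 else v $ 2)"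
  have "r \<noteq> 0"
  proof
    assume "r = 0"
    then have v12: "v $ 1 = 0" "v $ 2 = 0" by (auto simp: r_def split: if_splits)
    then have eq: "v = (v $ 3) *\<^sub>R vector [0, 0, 1]" by (simp add: vec_eq_iff forall_3 vector_3)
    have "v $ 3 \<noteq> 0" using v(1) v12 by (auto simp: vec_eq_iff forall_3)
    moreover have "(v $ 3) ^ d * f (vector [0, 0, 1]) = 0"
      using v(2) ternary_form_scaleR[OF f, of "v $ 3" "vector [0, 0, 1]"] eq by simp
    ultimately show False using no_zero by simp
  qed
  have "normalized (inverse r *\<^sub>R v)"
    using \<open>r \<noteq> 0\<close> by (auto simp: normalized_def r_def)
  moreover have "f (inverse r *\<^sub>R v) = 0" by (simp add: ternary_form_scaleR[OF f] v(2))
  moreover have "L = span {inverse r *\<^sub>R v}"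
    unfolding L using span_image_scale[of "{v}" "\<lambda>_. inverse r"] \<open>r \<noteq> 0\<close> by simp
  ultimately show "L \<in> (\<lambda>v. span {v}) ` {v. normalized v \<and> f v = 0}" by blast
next
  fix L assume "L \<in> (\<lambda>v. span {v}) ` {v. normalized v \<and> f v = 0}"
  then obtain v where v: "normalized v" "f v = 0" "L = span {v}" by blast
  moreover have "v \<noteq> 0" using v(1) by (auto simp: normalized_def)
  ultimately show "L \<in> form_zeros f" unfolding form_zeros_def by blast
qed

lemma normalized_zeros_Mt:
  assumes t: "t^2 < 1/2"
  shows "{v. normalized v \<and> Mt t v = 0} =
    {vector [1, 1, 1], vector [1, 1, - 1], vector [1, - 1, 1], vector [1, - 1, - 1],
     vector [1, 0, 0], vector [1, 0, t], vector [1, 0, - t],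
     vector [0, 1, 0], vector [0, 1, t], vector [0, 1, - t]}" (is "?Z = ?V")
proof (rule set_eqI)
  fix v :: "real^3"
  have x1: "Mt t (vector [1, y, z]) = 0 \<longleftrightarrow>
      (y = 1 \<or> y = - 1) \<and> (z = 1 \<or> z = - 1) \<or> y = 0 \<and> (z = 0 \<or> z = t \<or> z = - t)" for y z
    using t by (subst Mt_eq_0_iff) (auto simp: power2_eq_1_iff power2_eq_iff)
  have x0: "Mt t (vector [0, 1, z]) = 0 \<longleftrightarrow> z = 0 \<or> z = t \<or> z = - t" for z
    using t by (subst Mt_eq_0_iff) (auto simp: power2_eq_iff)
  obtain x y z where v: "v = vector [x, y, z]" using vec3_eq by blast
  have vec: "(vector [x, y, z] = (vector [x', y', z'] :: real^3)) \<longleftrightarrow> x = x' \<and> y = y' \<and> z = z'"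
    for x' y' z' by (simp add: vec_eq_iff forall_3 vector_3)
  have "v \<in> ?Z \<longleftrightarrow> x = 1 \<and> Mt t (vector [1, y, z]) = 0
      \<or> x = 0 \<and> y = 1 \<and> Mt t (vector [0, 1, z]) = 0"
    by (auto simp: v normalized_def vector_3)
  also have "\<dots> \<longleftrightarrow> v \<in> ?V"
    unfolding x1 x0 v by (auto simp: vec)
  finally show "v \<in> ?Z \<longleftrightarrow> v \<in> ?V" .
qed

lemma card_form_zeros_Mt:
  assumes t: "t^2 < 1/2" and "t \<noteq> 0"
  shows "card (form_zeros (Mt t)) = 10"
proof -
  have "Mt t (vector [0, 0, 1]) \<noteq> 0" by (simp add: Mt_vector)
  then have "form_zeros (Mt t) = (\<lambda>v. span {v}) ` {v. normalized v \<and> Mt t v = 0}"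
    by (rule form_zeros_normalized[OF ternary_form_Mt])
  moreover have "inj_on (\<lambda>v. span {v}) {v. normalized v \<and> Mt t v = 0}"
    by (rule inj_on_subset[OF inj_on_span_normalized]) auto
  ultimately have "card (form_zeros (Mt t)) = card {v. normalized v \<and> Mt t v = 0}"
    by (simp add: card_image)
  also have "\<dots> = 10"
    \<comment> \<open>As 0, t and -t are distinct, the count is 4 + 3 + 3.\<close>
    unfolding normalized_zeros_Mt[OF t] using \<open>t \<noteq> 0\<close>
    by (simp add: vec_eq_iff forall_3 vector_3)
  finally show ?thesis .
qed

theorem mainTheorem12:
  fixes t :: real
  assumes "t^2 < 1/2"
  shows "Mt t \<in> Delta_3_6 \<and> (t \<noteq> 0 \<longrightarrow> card (form_zeros (Mt t)) = 10) \<and> Mt 0 = M"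
proof (intro conjI impI)
  show "Mt t \<in> Delta_3_6"
    unfolding Delta_3_6_def
    using ternary_form_Mt psd_Mt[OF assms] not_sos_Mt[OF assms] by blast
  show "card (form_zeros (Mt t)) = 10" if "t \<noteq> 0"
    using card_form_zeros_Mt[OF assms that] .
  show "Mt 0 = M"
    by (rule ext) (simp add: Mt_def M_def Let_def)
qed

end
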